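(* Let $\Phi:\mathsf X\to\mathsf B$ be a fibration of categories and let $J$ be an object of $\mathsf B$. Then the inclusion functor $i_J:\mathsf X_J\to\mathsf X$ of the fibre over $J$ preserves colimits of connected diagrams. That is, if $\mathsf C$ is a small connected category, $T:\mathsf C\to\mathsf X_J$ is a functor, and $\gamma:T\Rightarrow L$ is a colimit cocone of $T$ in $\mathsf X_J$, then $i_J\gamma:i_JT\Rightarrow i_JL$ is a colimit cocone of $i_JT$ in $\mathsf X$.
   Context: For a functor $\Phi:\mathsf X\to\mathsf B$, a morphism $\varphi:Y\to X$ in $\mathsf X$ with $\Phi(\varphi)=u:J\to I$ is cartesian if for all $v:K\to J$ in $\mathsf B$ and all $\theta:Z\to X$ with $\Phi(\theta)=uv$ there is a unique $\psi:Z\to Y$ with $\Phi(\psi)=v$ and $\theta=\varphi\psi$. The functor $\Phi$ is a fibration if for all $u:J\to I$ in $\mathsf B$ and all $X$ with $\Phi(X)=I$ there is a cartesian morphism $Y\to X$ over $u$. The fibre $\mathsf X_J$ is the subcategory of $\mathsf X$ consisting of the objects $X$ with $\Phi(X)=J$ and the morphisms $\alpha$ with $\Phi(\alpha)=\mathrm{id}_J$. A category $\mathsf C$ is connected if for any objects $c,c'$ of $\mathsf C$ there is a sequence of objects $c_0=c,c_1,\ldots,c_{n-1},c_n=c'$ such that for each $i=0,\ldots,n-1$ there is a morphism $c_i\to c_{i+1}$ or $c_{i+1}\to c_i$ in $\mathsf C$.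
   Formalization: The connected category C is additionally required to be nonempty; for the empty category, which the stated definition of connected admits, the claim fails (take X = B discrete on two objects with the identity functor). *)

theory Defs
  imports Main
begin

record ('o, 'm) cat =
  Ob :: "'o set"
  Arr :: "'m set"
  Dom :: "'m \<Rightarrow> 'o"
  Cod :: "'m \<Rightarrow> 'o"
  Idt :: "'o \<Rightarrow> 'm"
  Comp :: "'m \<Rightarrow> 'm \<Rightarrow> 'm" (infixr "\<cdot>\<index>" 70)

definition Hom :: "('o, 'm) cat \<Rightarrow> 'o \<Rightarrow> 'o \<Rightarrow> 'm set" where
  "Hom C x y = {f \<in> Arr C. Dom C f = x \<and> Cod C f = y}"

text \<open>Composition is written in applicative order: \<open>g \<cdot> f\<close> is \<open>f\<close> followed by \<open>g\<close>.
  The operations are total functions of which only the values on the carriers matter.\<close>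

locale category =
  fixes C :: "('o, 'm) cat" (structure)
  assumes Dom_in_Ob: "f \<in> Arr C \<Longrightarrow> Dom C f \<in> Ob C"
    and Cod_in_Ob: "f \<in> Arr C \<Longrightarrow> Cod C f \<in> Ob C"
    and Idt_in_Hom: "x \<in> Ob C \<Longrightarrow> Idt C x \<in> Hom C x x"
    and Comp_in_Hom: "\<lbrakk>f \<in> Hom C x y; g \<in> Hom C y z\<rbrakk> \<Longrightarrow> g \<cdot> f \<in> Hom C x z"
    and Comp_Idt: "f \<in> Hom C x y \<Longrightarrow> f \<cdot> Idt C x = f"
    and Idt_Comp: "f \<in> Hom C x y \<Longrightarrow> Idt C y \<cdot> f = f"
    and Comp_assoc: "\<lbrakk>f \<in> Hom C w x; g \<in> Hom C x y; h \<in> Hom C y z\<rbrakk>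
      \<Longrightarrow> (h \<cdot> g) \<cdot> f = h \<cdot> (g \<cdot> f)"

text \<open>The empty category is excluded, as usual for connectedness: an initial object
  of a fibre need not be initial in the total category.\<close>

locale connected_category = category C for C :: "('o, 'm) cat" (structure) +
  assumes nonempty: "Ob C \<noteq> {}"
    and zigzag: "\<lbrakk>c \<in> Ob C; c' \<in> Ob C\<rbrakk> \<Longrightarrow>
      \<exists>n (s :: nat \<Rightarrow> 'o). s 0 = c \<and> s n = c' \<and> (\<forall>i\<le>n. s i \<in> Ob C) \<and>
        (\<forall>i<n. Hom C (s i) (s (Suc i)) \<noteq> {} \<or> Hom C (s (Suc i)) (s i) \<noteq> {})"

record ('o1, 'm1, 'o2, 'm2) fctr =
  OMap :: "'o1 \<Rightarrow> 'o2"
  AMap :: "'m1 \<Rightarrow> 'm2"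

locale cat_functor = C: category C + D: category D
  for C :: "('o1, 'm1) cat" and D :: "('o2, 'm2) cat" +
  fixes F :: "('o1, 'm1, 'o2, 'm2) fctr"
  assumes OMap_in_Ob: "x \<in> Ob C \<Longrightarrow> OMap F x \<in> Ob D"
    and AMap_in_Hom: "f \<in> Hom C x y \<Longrightarrow> AMap F f \<in> Hom D (OMap F x) (OMap F y)"
    and AMap_Idt: "x \<in> Ob C \<Longrightarrow> AMap F (Idt C x) = Idt D (OMap F x)"
    and AMap_Comp: "\<lbrakk>f \<in> Hom C x y; g \<in> Hom C y z\<rbrakk>
      \<Longrightarrow> AMap F (g \<cdot>\<^bsub>C\<^esub> f) = AMap F g \<cdot>\<^bsub>D\<^esub> AMap F f"

definition fctr_comp ::
    "('o2, 'm2, 'o3, 'm3) fctr \<Rightarrow> ('o1, 'm1, 'o2, 'm2) fctr \<Rightarrow> ('o1, 'm1, 'o3, 'm3) fctr"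
    (infixr "\<circ>\<^sub>F" 55) where
  "G \<circ>\<^sub>F F = \<lparr>OMap = OMap G \<circ> OMap F, AMap = AMap G \<circ> AMap F\<rparr>"

definition cartesian ::
    "('o1, 'm1) cat \<Rightarrow> ('o2, 'm2) cat \<Rightarrow> ('o1, 'm1, 'o2, 'm2) fctr \<Rightarrow> 'm1 \<Rightarrow> bool" where
  "cartesian X B \<Phi> \<phi> \<longleftrightarrow> \<phi> \<in> Arr X \<and>
    (\<forall>K \<in> Ob B. \<forall>v \<in> Hom B K (OMap \<Phi> (Dom X \<phi>)).
      \<forall>z \<in> Ob X. \<forall>\<theta> \<in> Hom X z (Cod X \<phi>). AMap \<Phi> \<theta> = AMap \<Phi> \<phi> \<cdot>\<^bsub>B\<^esub> v \<longrightarrow>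
        (\<exists>!\<psi>. \<psi> \<in> Hom X z (Dom X \<phi>) \<and> AMap \<Phi> \<psi> = v \<and> \<theta> = \<phi> \<cdot>\<^bsub>X\<^esub> \<psi>))"

locale fibration = cat_functor X B \<Phi>
  for X :: "('o1, 'm1) cat" and B :: "('o2, 'm2) cat"
    and \<Phi> :: "('o1, 'm1, 'o2, 'm2) fctr" +
  assumes cartesian_lift: "\<lbrakk>u \<in> Hom B J I; x \<in> Ob X; OMap \<Phi> x = I\<rbrakk> \<Longrightarrow>
    \<exists>y \<in> Ob X. \<exists>\<phi> \<in> Hom X y x. AMap \<Phi> \<phi> = u \<and> cartesian X B \<Phi> \<phi>"

definition fibre ::
    "('o1, 'm1) cat \<Rightarrow> ('o2, 'm2) cat \<Rightarrow> ('o1, 'm1, 'o2, 'm2) fctr \<Rightarrow> 'o2 \<Rightarrow> ('o1, 'm1) cat" where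
  "fibre X B \<Phi> J = X\<lparr>Ob := {x \<in> Ob X. OMap \<Phi> x = J},
                      Arr := {\<alpha> \<in> Arr X. AMap \<Phi> \<alpha> = Idt B J}\<rparr>"

text \<open>Fibres share the types of objects and arrows with the total category, so the
  inclusion of a fibre is the identity on the underlying types.\<close>

definition incl :: "('o, 'm, 'o, 'm) fctr" where
  "incl = \<lparr>OMap = \<lambda>x. x, AMap = \<lambda>f. f\<rparr>"

locale cocone = T: cat_functor C D T
  for C :: "('o1, 'm1) cat" and D :: "('o2, 'm2) cat"
    and T :: "('o1, 'm1, 'o2, 'm2) fctr" +
  fixes L :: 'o2 and \<gamma> :: "'o1 \<Rightarrow> 'm2"
  assumes vertex_in_Ob: "L \<in> Ob D"
    and component_in_Hom: "c \<in> Ob C \<Longrightarrow> \<gamma> c \<in> Hom D (OMap T c) L"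
    and naturality: "f \<in> Hom C c c' \<Longrightarrow> \<gamma> c' \<cdot>\<^bsub>D\<^esub> AMap T f = \<gamma> c"

locale colimit_cocone = cocone +
  assumes universal: "cocone C D T M \<mu> \<Longrightarrow>
    \<exists>!h. h \<in> Hom D L M \<and> (\<forall>c \<in> Ob C. h \<cdot>\<^bsub>D\<^esub> \<gamma> c = \<mu> c)"

definition whisker ::
    "('o2, 'm2, 'o3, 'm3) fctr \<Rightarrow> ('o1 \<Rightarrow> 'm2) \<Rightarrow> 'o1 \<Rightarrow> 'm3" where
  "whisker F \<gamma> = (\<lambda>c. AMap F (\<gamma> c))"

lemma Hom_fibre:
  "Hom (fibre X B \<Phi> J) x y = {\<alpha> \<in> Hom X x y. AMap \<Phi> \<alpha> = Idt B J}"
  by (auto simp: Hom_def fibre_def)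

lemma fibre_sel [simp]:
  "Ob (fibre X B \<Phi> J) = {x \<in> Ob X. OMap \<Phi> x = J}"
  "Arr (fibre X B \<Phi> J) = {\<alpha> \<in> Arr X. AMap \<Phi> \<alpha> = Idt B J}"
  "Dom (fibre X B \<Phi> J) = Dom X"
  "Cod (fibre X B \<Phi> J) = Cod X"
  "Idt (fibre X B \<Phi> J) = Idt X"
  "Comp (fibre X B \<Phi> J) = Comp X"
  by (simp_all add: fibre_def)

context cat_functor
begin

lemma AMap_Idt_Dom_Cod:
  assumes "f \<in> Arr C" "AMap F f = Idt D J" "J \<in> Ob D"
  shows "OMap F (Dom C f) = J \<and> OMap F (Cod C f) = J"
  using assms AMap_in_Hom[of f "Dom C f" "Cod C f"] D.Idt_in_Hom[of J]
  by (auto simp: Hom_def)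

lemma category_fibre:
  assumes J: "J \<in> Ob D"
  shows "category (fibre C D F J)"
proof
  fix f x y z g
  assume "f \<in> Hom (fibre C D F J) x y" "g \<in> Hom (fibre C D F J) y z"
  then have f: "f \<in> Hom C x y" "AMap F f = Idt D J"
    and g: "g \<in> Hom C y z" "AMap F g = Idt D J"
    by (auto simp: Hom_fibre)
  have "AMap F (g \<cdot>\<^bsub>C\<^esub> f) = Idt D J"
    using AMap_Comp[OF f(1) g(1)] f(2) g(2) D.Comp_Idt[OF D.Idt_in_Hom[OF J]] by simp
  then show "g \<cdot>\<^bsub>fibre C D F J\<^esub> f \<in> Hom (fibre C D F J) x z"
    using C.Comp_in_Hom[OF f(1) g(1)] by (simp add: Hom_fibre)
next
  fix f assume "f \<in> Arr (fibre C D F J)"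
  then have f: "f \<in> Arr C" "AMap F f = Idt D J" by auto
  from AMap_Idt_Dom_Cod[OF f J]
  show "Dom (fibre C D F J) f \<in> Ob (fibre C D F J)" "Cod (fibre C D F J) f \<in> Ob (fibre C D F J)"
    using f C.Dom_in_Ob C.Cod_in_Ob by auto
next
  fix x assume "x \<in> Ob (fibre C D F J)"
  then show "Idt (fibre C D F J) x \<in> Hom (fibre C D F J) x x"
    using C.Idt_in_Hom AMap_Idt by (auto simp: Hom_def)
qed (auto simp: Hom_fibre C.Comp_Idt C.Idt_Comp intro: C.Comp_assoc)

lemma cat_functor_incl:
  assumes J: "J \<in> Ob D"
  shows "cat_functor (fibre C D F J) C incl"
proof -
  interpret fib: category "fibre C D F J" by (rule category_fibre[OF J])
  show ?thesis
    by unfold_locales (auto simp: Hom_fibre incl_def)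
qed

end

end

theory Submission imports Defs begin

text \<open>All components of a cocone in the total category from a connected diagram in the fibre over
  \<open>J\<close> lie over a single arrow \<open>u\<close> out of \<open>J\<close>. Factoring them through a cartesian lift of \<open>u\<close>
  turns cocones over \<open>u\<close> into cocones in the fibre, and likewise for arrows out of the colimit,
  which are forced to lie over \<open>u\<close> because the diagram is nonempty.\<close>

lemma incl_sel [simp]: "OMap incl x = x" "AMap incl f = f"
  by (simp_all add: incl_def)

lemma fctr_comp_sel [simp]:
  "OMap (G \<circ>\<^sub>F F) x = OMap G (OMap F x)" "AMap (G \<circ>\<^sub>F F) f = AMap G (AMap F f)"
  by (simp_all add: fctr_comp_def)

lemma whisker_incl [simp]: "whisker incl \<gamma> = \<gamma>"
  by (simp add: whisker_def)

lemma (in category) Hom_Ob: "f \<in> Hom C x y \<Longrightarrow> x \<in> Ob C \<and> y \<in> Ob C"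
  using Dom_in_Ob Cod_in_Ob by (auto simp: Hom_def)

text \<open>Induction along a zigzag from \<open>c\<close> to \<open>c'\<close>. Equality is
  symmetric, so the direction in which each arrow of the zigzag points does not matter.\<close>

lemma (in connected_category) constant_if_constant_on_arrows:
  assumes step: "\<And>f c c'. f \<in> Hom C c c' \<Longrightarrow> P c = P c'"
    and "c \<in> Ob C" "c' \<in> Ob C"
  shows "P c = P c'"
proof -
  obtain n s where s: "s 0 = c" "s n = c'"
    and adj: "\<forall>i<n. Hom C (s i) (s (Suc i)) \<noteq> {} \<or> Hom C (s (Suc i)) (s i) \<noteq> {}"
    using zigzag[OF assms(2,3)] by blast
  have "P (s i) = P c" if "i \<le> n" for i
    using that
  proof (induction i)
    case (Suc i)
    then have "P (s i) = P (s (Suc i))"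
      using adj step by (metis Suc_le_lessD ex_in_conv)
    with Suc show ?case by simp
  qed (simp add: s)
  from this[of n] show ?thesis by (simp add: s)
qed

lemma cat_functor_comp:
  assumes "cat_functor C D F" "cat_functor D E G"
  shows "cat_functor C E (G \<circ>\<^sub>F F)"
proof -
  interpret F: cat_functor C D F by fact
  interpret G: cat_functor D E G by fact
  show ?thesis
    by unfold_locales
      (auto simp: F.AMap_Idt G.AMap_Idt F.OMap_in_Ob F.AMap_Comp
        G.AMap_Comp[OF F.AMap_in_Hom F.AMap_in_Hom]
        intro: G.OMap_in_Ob F.AMap_in_Hom G.AMap_in_Hom)
qed

text \<open>Cartesianness with \<open>v\<close> taken to be the identity of \<open>J\<close>: since
  \<open>\<theta>\<close> and \<open>\<phi>\<close> lie over the same arrow, the factor is vertical,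
  that is, an arrow of the fibre. The uniqueness part lets \<open>\<phi>\<close> be cancelled on the
  left of vertical arrows.\<close>

lemma (in cat_functor) cartesian_factor_over_Idt:
  assumes \<phi>: "cartesian C D F \<phi>" "\<phi> \<in> Hom C y x" and y: "OMap F y = J" and J: "J \<in> Ob D"
    and \<theta>: "\<theta> \<in> Hom C z x" and eq: "AMap F \<theta> = AMap F \<phi>"
  shows "\<exists>!\<psi>. \<psi> \<in> Hom (fibre C D F J) z y \<and> \<phi> \<cdot>\<^bsub>C\<^esub> \<psi> = \<theta>"
proof -
  have dc: "Dom C \<phi> = y" "Cod C \<phi> = x" using \<phi>(2) by (auto simp: Hom_def)
  have z: "z \<in> Ob C" using C.Hom_Ob[OF \<theta>] by simp
  have I: "Idt D J \<in> Hom D J (OMap F (Dom C \<phi>))"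
    using D.Idt_in_Hom[OF J] y dc by simp
  have "AMap F \<theta> = AMap F \<phi> \<cdot>\<^bsub>D\<^esub> Idt D J"
    using D.Comp_Idt[OF AMap_in_Hom[OF \<phi>(2)]] y eq by simp
  then have "\<exists>!\<psi>. \<psi> \<in> Hom C z (Dom C \<phi>) \<and> AMap F \<psi> = Idt D J \<and> \<theta> = \<phi> \<cdot>\<^bsub>C\<^esub> \<psi>"
    using \<phi>(1) J I z \<theta> unfolding cartesian_def dc(2) by blast
  then show ?thesis
    unfolding Hom_fibre dc by (simp add: conj_assoc eq_commute[of \<theta>])
qed

text \<open>Arrows of the diagram are vertical, so applying \<open>\<Phi>\<close> to the naturality
  triangles identifies the images of components at the two ends of any arrow of \<open>C\<close>;
  connectedness spreads this to all objects.\<close>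

lemma (in fibration) cocone_over_common_arrow:
  assumes "J \<in> Ob B" "connected_category C" "cat_functor C (fibre X B \<Phi> J) T"
    and "cocone C X (incl \<circ>\<^sub>F T) M \<mu>"
  shows "\<exists>u \<in> Hom B J (OMap \<Phi> M). \<forall>c \<in> Ob C. AMap \<Phi> (\<mu> c) = u"
proof -
  interpret K: connected_category C by fact
  interpret T: cat_functor C "fibre X B \<Phi> J" T by fact
  interpret \<mu>: cocone C X "incl \<circ>\<^sub>F T" M \<mu> by fact
  have over: "AMap \<Phi> (\<mu> c) \<in> Hom B J (OMap \<Phi> M)" if "c \<in> Ob C" for c
    using AMap_in_Hom[OF \<mu>.component_in_Hom[OF that]] T.OMap_in_Ob[OF that] by simp
  have const: "AMap \<Phi> (\<mu> c) = AMap \<Phi> (\<mu> c')" if f: "f \<in> Hom C c c'" for f c c'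
  proof -
    have c': "c' \<in> Ob C" using K.Hom_Ob[OF f] by simp
    have Tf: "AMap T f \<in> Hom X (OMap T c) (OMap T c')" "AMap \<Phi> (AMap T f) = Idt B J"
      using T.AMap_in_Hom[OF f] by (auto simp: Hom_fibre)
    have \<mu>c': "\<mu> c' \<in> Hom X (OMap T c') M" using \<mu>.component_in_Hom[OF c'] by simp
    have "AMap \<Phi> (\<mu> c) = AMap \<Phi> (\<mu> c') \<cdot>\<^bsub>B\<^esub> Idt B J"
      using \<mu>.naturality[OF f] AMap_Comp[OF Tf(1) \<mu>c'] Tf(2) by simp
    then show ?thesis using D.Comp_Idt[OF over[OF c']] by simp
  qed
  \<comment> \<open>The arrow \<open>u\<close> is the image of the component at an arbitrarily
    chosen object.\<close>
  obtain c where "c \<in> Ob C" using K.nonempty by blast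
  with over K.constant_if_constant_on_arrows[of "\<lambda>c. AMap \<Phi> (\<mu> c)"] const
  show ?thesis by blast
qed

theorem theorem2p7:
  fixes X :: "('xo, 'xm) cat" and B :: "('bo, 'bm) cat"
    and \<Phi> :: "('xo, 'xm, 'bo, 'bm) fctr" and J :: 'bo
    and C :: "('co, 'cm) cat" and T :: "('co, 'cm, 'xo, 'xm) fctr"
    and L :: 'xo and \<gamma> :: "'co \<Rightarrow> 'xm"
  assumes "fibration X B \<Phi>"
    and "J \<in> Ob B"
    and "connected_category C"
    and "cat_functor C (fibre X B \<Phi> J) T"
    and "colimit_cocone C (fibre X B \<Phi> J) T L \<gamma>"
  shows "colimit_cocone C X (incl \<circ>\<^sub>F T) (OMap incl L) (whisker incl \<gamma>)"
proof -
  interpret fibration X B \<Phi> by fact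
  interpret K: connected_category C by fact
  interpret T: cat_functor C "fibre X B \<Phi> J" T by fact
  interpret \<gamma>: colimit_cocone C "fibre X B \<Phi> J" T L \<gamma> by fact
  interpret iT: cat_functor C X "incl \<circ>\<^sub>F T"
    by (rule cat_functor_comp[OF assms(4) cat_functor_incl[OF assms(2)]])
  have \<gamma>: "\<gamma> c \<in> Hom X (OMap T c) L" "AMap \<Phi> (\<gamma> c) = Idt B J" if "c \<in> Ob C" for c
    using \<gamma>.component_in_Hom[OF that] by (auto simp: Hom_fibre)
  have L: "OMap \<Phi> L = J" using \<gamma>.vertex_in_Ob by simp
  \<comment> \<open>The inclusion acts as the identity on vertex and components, so it is erased
    from both here and restored by simplification at the end.\<close>
  have "colimit_cocone C X (incl \<circ>\<^sub>F T) L \<gamma>"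
  proof
    show "L \<in> Ob X" using \<gamma>.vertex_in_Ob by simp
  next
    fix M \<mu>
    assume "cocone C X (incl \<circ>\<^sub>F T) M \<mu>"
    then interpret \<mu>: cocone C X "incl \<circ>\<^sub>F T" M \<mu> .
    have \<mu>: "\<mu> c \<in> Hom X (OMap T c) M" if "c \<in> Ob C" for c
      using \<mu>.component_in_Hom[OF that] by simp
    obtain u where u: "u \<in> Hom B J (OMap \<Phi> M)" "\<And>c. c \<in> Ob C \<Longrightarrow> AMap \<Phi> (\<mu> c) = u"
      using cocone_over_common_arrow[OF assms(2-4) \<mu>.cocone_axioms] by blast
    obtain y \<phi> where y: "y \<in> Ob X" and \<phi>: "\<phi> \<in> Hom X y M" "AMap \<Phi> \<phi> = u" "cartesian X B \<Phi> \<phi>"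
      using cartesian_lift[OF u(1) \<mu>.vertex_in_Ob] by blast
    \<comment> \<open>The lift starts over the domain of \<open>u\<close>, so its source is an
      object of the fibre and can be the vertex of a cocone there.\<close>
    have yJ: "OMap \<Phi> y = J"
      using AMap_in_Hom[OF \<phi>(1)] \<phi>(2) u(1) by (auto simp: Hom_def)
    note factor = cartesian_factor_over_Idt[OF \<phi>(3,1) yJ assms(2)]
    have "\<forall>c\<in>Ob C. \<exists>\<psi>. \<psi> \<in> Hom (fibre X B \<Phi> J) (OMap T c) y \<and> \<phi> \<cdot>\<^bsub>X\<^esub> \<psi> = \<mu> c"
      using factor[OF \<mu>] u(2) \<phi>(2) by blast
    then obtain \<psi> where
      \<psi>: "\<And>c. c \<in> Ob C \<Longrightarrow> \<psi> c \<in> Hom (fibre X B \<Phi> J) (OMap T c) y"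
         "\<And>c. c \<in> Ob C \<Longrightarrow> \<phi> \<cdot>\<^bsub>X\<^esub> \<psi> c = \<mu> c"
      using bchoice[of "Ob C"] by metis
    \<comment> \<open>Vertical arrows into \<open>y\<close> are compared after composing with
      \<open>\<phi>\<close>. This serves twice: for naturality of \<open>\<psi>\<close>, and for the
      uniqueness of the mediating arrow.\<close>
    have \<psi>_eqI: "\<chi> = \<psi> c"
      if "c \<in> Ob C" "\<chi> \<in> Hom (fibre X B \<Phi> J) (OMap T c) y" "\<phi> \<cdot>\<^bsub>X\<^esub> \<chi> = \<mu> c" for c \<chi>
      using factor[OF \<mu>[OF that(1)]] u(2)[OF that(1)] \<phi>(2) \<psi>[OF that(1)] that(2,3) by metis
    have "cocone C (fibre X B \<Phi> J) T y \<psi>"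
    proof
      show "y \<in> Ob (fibre X B \<Phi> J)" using y yJ by simp
    next
      fix f c c' assume f: "f \<in> Hom C c c'"
      then have c: "c \<in> Ob C" "c' \<in> Ob C" using K.Hom_Ob by blast+
      show "\<psi> c' \<cdot>\<^bsub>fibre X B \<Phi> J\<^esub> AMap T f = \<psi> c"
      proof (rule \<psi>_eqI[OF c(1)])
        show "\<psi> c' \<cdot>\<^bsub>fibre X B \<Phi> J\<^esub> AMap T f \<in> Hom (fibre X B \<Phi> J) (OMap T c) y"
          by (rule T.D.Comp_in_Hom[OF T.AMap_in_Hom[OF f] \<psi>(1)[OF c(2)]])
        have "\<phi> \<cdot>\<^bsub>X\<^esub> (\<psi> c' \<cdot>\<^bsub>X\<^esub> AMap T f) = (\<phi> \<cdot>\<^bsub>X\<^esub> \<psi> c') \<cdot>\<^bsub>X\<^esub> AMap T f"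
          using T.AMap_in_Hom[OF f] \<psi>(1)[OF c(2)]
          by (auto simp: Hom_fibre intro: C.Comp_assoc[OF _ _ \<phi>(1), symmetric])
        then show "\<phi> \<cdot>\<^bsub>X\<^esub> (\<psi> c' \<cdot>\<^bsub>fibre X B \<Phi> J\<^esub> AMap T f) = \<mu> c"
          using \<mu>.naturality[OF f] \<psi>(2)[OF c(2)] by simp
      qed
    qed (rule \<psi>(1))
    then have ex1: "\<exists>!h. h \<in> Hom (fibre X B \<Phi> J) L y \<and> (\<forall>c\<in>Ob C. h \<cdot>\<^bsub>X\<^esub> \<gamma> c = \<psi> c)"
      using \<gamma>.universal by simp
    then obtain h where h: "h \<in> Hom (fibre X B \<Phi> J) L y" "\<And>c. c \<in> Ob C \<Longrightarrow> h \<cdot>\<^bsub>X\<^esub> \<gamma> c = \<psi> c"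
      by blast
    have assoc: "(\<phi> \<cdot>\<^bsub>X\<^esub> k) \<cdot>\<^bsub>X\<^esub> \<gamma> c = \<phi> \<cdot>\<^bsub>X\<^esub> (k \<cdot>\<^bsub>X\<^esub> \<gamma> c)"
      if "k \<in> Hom (fibre X B \<Phi> J) L y" "c \<in> Ob C" for k c
      using C.Comp_assoc[OF \<gamma>(1)[OF that(2)] _ \<phi>(1)] that(1) by (simp add: Hom_fibre)
    show "\<exists>!k. k \<in> Hom X L M \<and> (\<forall>c\<in>Ob C. k \<cdot>\<^bsub>X\<^esub> \<gamma> c = \<mu> c)"
    \<comment> \<open>The mediating arrow to \<open>M\<close> is the one to \<open>y\<close>
      supplied by the colimit in the fibre, followed by the cartesian lift.\<close>
    proof (rule ex1I[of _ "\<phi> \<cdot>\<^bsub>X\<^esub> h"])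
      show "\<phi> \<cdot>\<^bsub>X\<^esub> h \<in> Hom X L M \<and> (\<forall>c\<in>Ob C. (\<phi> \<cdot>\<^bsub>X\<^esub> h) \<cdot>\<^bsub>X\<^esub> \<gamma> c = \<mu> c)"
        using C.Comp_in_Hom[OF _ \<phi>(1)] h assoc[OF h(1)] \<psi>(2) by (simp add: Hom_fibre)
    next
      fix k assume k: "k \<in> Hom X L M \<and> (\<forall>c\<in>Ob C. k \<cdot>\<^bsub>X\<^esub> \<gamma> c = \<mu> c)"
      obtain c where c: "c \<in> Ob C" using K.nonempty by blast
      \<comment> \<open>A competitor \<open>k\<close> lies over \<open>u\<close>: the component
        \<open>\<gamma> c\<close> is vertical, so \<open>k\<close> has the same image as its
        composite with \<open>\<gamma> c\<close>, which is \<open>\<mu> c\<close>. One object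
        \<open>c\<close> suffices.\<close>
      have "AMap \<Phi> k = AMap \<Phi> k \<cdot>\<^bsub>B\<^esub> AMap \<Phi> (\<gamma> c)"
        using D.Comp_Idt[OF AMap_in_Hom] k \<gamma>(2)[OF c] L by metis
      also have "\<dots> = u"
        using AMap_Comp[OF \<gamma>(1)[OF c]] k c u(2)[OF c] by metis
      finally obtain k' where k': "k' \<in> Hom (fibre X B \<Phi> J) L y" "\<phi> \<cdot>\<^bsub>X\<^esub> k' = k"
        using factor[of k L] k \<phi>(2) by auto
      \<comment> \<open>The vertical factor \<open>k'\<close> of \<open>k\<close> also mediates from
        \<open>\<gamma>\<close> to \<open>\<psi>\<close>, so uniqueness in the fibre identifies it
        with \<open>h\<close>.\<close>
      have "k' \<cdot>\<^bsub>X\<^esub> \<gamma> c = \<psi> c" if c: "c \<in> Ob C" for c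
      proof (rule \<psi>_eqI[OF c])
        show "k' \<cdot>\<^bsub>X\<^esub> \<gamma> c \<in> Hom (fibre X B \<Phi> J) (OMap T c) y"
          using T.D.Comp_in_Hom[OF \<gamma>.component_in_Hom[OF c] k'(1)] by simp
        show "\<phi> \<cdot>\<^bsub>X\<^esub> (k' \<cdot>\<^bsub>X\<^esub> \<gamma> c) = \<mu> c"
          using assoc[OF k'(1) c] k'(2) k c by simp
      qed
      with ex1 h k'(1) have "k' = h" by blast
      with k'(2) show "k = \<phi> \<cdot>\<^bsub>X\<^esub> h" by simp
    qed
  qed (use \<gamma>(1) \<gamma>.naturality in auto)
  then show ?thesis by simp
qed

end
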